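(* (a) Let $B\subset\mathbb{Z}$ be a set with $4$ elements which is spectral with spectrum $\Lambda\subset\mathbb{R}$, and assume $0\in B$ and $0\in\Lambda$. Then there exist a set of integers $L$ containing $0$ and an integer scaling factor $R\ge2$ such that $\Lambda=\frac1RL$. (b) Let $R\ge2$ be an integer and let $B,L$ be subsets of $\mathbb{Z}$, each containing $0$ and each of size $4$. Then $(B,L)$ is a Hadamard pair with scaling factor $R$ if and only if $$R=2^{C+M+a+1}d,\quad B=2^C\{0,2^ac_1,c_2,c_2+2^ac_3\},\quad L=2^M\{0,n_1,n_1+2^an_2,2^an_3\},$$ where $c_1,c_2,c_3,n_1,n_2,n_3$ are odd integers, $a$ is a positive integer, $C$ and $M$ are nonnegative integers, and $d$ is an integer that divides $c_1n$, $c_3n$, $n_2c$ and $n_3c$, where $c=\gcd(c_1,c_2,c_3)$ and $n=\gcd(n_1,n_2,n_3)$.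
   Context: A finite set $B\subset\mathbb{R}$ is spectral with spectrum $\Lambda\subset\mathbb{R}$ if $\{e^{2\pi i\lambda x}:\lambda\in\Lambda\}$ is an orthogonal basis of $L^2$ of the counting measure on $B$. For an integer $R\ge2$ and finite sets $B,L\subset\mathbb{Z}$ with $0\in B$, $0\in L$, $(B,L)$ is a Hadamard pair with scaling factor $R$ if $\#B=\#L=N$ and the matrix $\frac{1}{\sqrt N}\left(e^{2\pi i R^{-1}bl}\right)_{b\in B,l\in L}$ is unitary. For a set $A$ and a number $t$, $tA=\{ta:a\in A\}$. *)

theory Defs
  imports "HOL-Analysis.Analysis"
begin

definition expfun :: "real \<Rightarrow> real \<Rightarrow> complex" where
  "expfun t x = exp (2 * of_real pi * \<i> * of_real t * of_real x)"

definition count_inner :: "real set \<Rightarrow> (real \<Rightarrow> complex) \<Rightarrow> (real \<Rightarrow> complex) \<Rightarrow> complex" where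
  "count_inner B f g = (LINT x|count_space B. f x * cnj (g x))"

text \<open>
  A Hilbert space basis of the space \<open>L\<^sup>2\<close> of the counting measure on a finite set \<open>B\<close>, which
  consists of all functions on \<open>B\<close>. Functions are total on \<open>real\<close>, but only their values on \<open>B\<close>
  matter. The space is finite-dimensional, so completeness means that the finite linear
  combinations exhaust it. The basis is an indexed family: distinct indices give orthogonal
  functions.
\<close>

definition orthogonal_basis_on ::
  "real set \<Rightarrow> 'i set \<Rightarrow> ('i \<Rightarrow> real \<Rightarrow> complex) \<Rightarrow> bool" where
  "orthogonal_basis_on B I e \<longleftrightarrow>
     (\<forall>i\<in>I. count_inner B (e i) (e i) \<noteq> 0) \<and>
     (\<forall>i\<in>I. \<forall>j\<in>I. i \<noteq> j \<longrightarrow> count_inner B (e i) (e j) = 0) \<and>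
     (\<forall>f. \<exists>F c. finite F \<and> F \<subseteq> I \<and> (\<forall>x\<in>B. f x = (\<Sum>i\<in>F. c i * e i x)))"

definition spectral_with :: "real set \<Rightarrow> real set \<Rightarrow> bool" where
  "spectral_with B \<Lambda> \<longleftrightarrow> finite B \<and> orthogonal_basis_on B \<Lambda> expfun"

text \<open>
  Matrices with rows indexed by \<open>I\<close> and columns indexed by \<open>J\<close>; as the index sets differ, both
  \<open>U U\<^sup>* = 1\<close> and \<open>U\<^sup>* U = 1\<close> are required.
\<close>

definition unitary_matrix_on :: "'i set \<Rightarrow> 'j set \<Rightarrow> ('i \<Rightarrow> 'j \<Rightarrow> complex) \<Rightarrow> bool" where
  "unitary_matrix_on I J U \<longleftrightarrow>
     (\<forall>i\<in>I. \<forall>i'\<in>I. (\<Sum>j\<in>J. U i j * cnj (U i' j)) = (if i = i' then 1 else 0)) \<and>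
     (\<forall>j\<in>J. \<forall>j'\<in>J. (\<Sum>i\<in>I. cnj (U i j) * U i j') = (if j = j' then 1 else 0))"

definition hadamard_pair :: "int \<Rightarrow> int set \<Rightarrow> int set \<Rightarrow> bool" where
  "hadamard_pair R B L \<longleftrightarrow>
     R \<ge> 2 \<and> finite B \<and> finite L \<and> 0 \<in> B \<and> 0 \<in> L \<and> card B = card L \<and>
     unitary_matrix_on B L
       (\<lambda>b l. 1 / of_real (sqrt (real (card B))) *
              exp (2 * of_real pi * \<i> * inverse (of_int R) * of_int b * of_int l))"

end

theory Submission
  imports Defs
begin

text \<open>
  If four complex numbers of modulus one, one of them being \<open>1\<close>, add up to zero, then one of the
  other three is \<open>-1\<close> and the remaining two cancel. For (a) this gives, for every nonzero
  \<open>\<lambda> \<in> \<Lambda>\<close>, some \<open>b \<in> B\<close> such that \<open>2b\<lambda>\<close> is an odd integer, so twice the product of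
  the nonzero elements of \<open>B\<close> is a common denominator of \<open>\<Lambda>\<close>. For (b) it forces the matrix,
  up to permutations that fix the indices \<open>0\<close>, to have the rows \<open>(1, 1, 1, 1)\<close>, \<open>(1, -1, -1, 1)\<close>,
  \<open>(1, w, -w, -1)\<close>, \<open>(1, -w, w, -1)\<close>. Each entry is then a condition on an integer
  modulo \<open>R\<close>, and comparing the exponents of \<open>2\<close> and the odd parts gives the parametrization.
\<close>

section \<open>Vanishing sums of four unit complex numbers\<close>

text \<open>Inverses of unit numbers are their conjugates, so the conjugate equation times
  \<open>x * y * z\<close> says that the second and third elementary symmetric polynomials cancel.
  With \<open>s\<close> this makes \<open>(1 + x) * (1 + y) * (1 + z)\<close> vanish.\<close>

lemma unit_sum4_zero:
  fixes x y z :: complex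
  assumes "norm x = 1" "norm y = 1" "norm z = 1" and s: "1 + x + y + z = 0"
  shows "x = -1 \<or> y = -1 \<or> z = -1"
proof -
  have nz: "x \<noteq> 0" "y \<noteq> 0" "z \<noteq> 0"
    using assms by auto
  have inv: "x * cnj x = 1" "y * cnj y = 1" "z * cnj z = 1"
    using assms by (auto simp: complex_norm_square[symmetric])
  have c: "1 + cnj x + cnj y + cnj z = 0"
    using arg_cong[OF s, of cnj] by simp
  have "(1 + x) * (1 + y) * (1 + z) = 0"
    using s c inv by algebra
  then show ?thesis
    by (auto simp: add_eq_0_iff)
qed

lemma cis_2pi_eq_1_iff: "cis (2 * pi * t) = 1 \<longleftrightarrow> t \<in> \<int>"
proof
  assume "cis (2 * pi * t) = 1"
  then have "cos (2 * pi * t) = 1"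
    by (metis cis.sel(1) one_complex.sel(1))
  then obtain m :: int where "2 * pi * t = m * 2 * pi"
    by (auto simp: cos_one_2pi_int)
  then show "t \<in> \<int>"
    by simp
qed (auto elim!: Ints_cases intro: cis_multiple_2pi)

lemma cis_2pi_eq_minus_1:
  fixes t :: real
  assumes "cis (2 * pi * t) = -1"
  shows "\<exists>m::int. odd m \<and> 2 * t = m"
proof -
  have "cis (2 * pi * (t - 1/2)) = cis (2 * pi * t) * cis (- pi)"
    by (simp add: cis_mult algebra_simps)
  also have "\<dots> = 1"
    using assms by (simp add: cis.ctr complex_eq_iff)
  finally obtain k :: int where "t - 1/2 = k"
    by (auto simp: cis_2pi_eq_1_iff elim: Ints_cases)
  then have "2 * t = real_of_int (2 * k + 1)"
    by simp
  then show ?thesis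
    by (metis odd_add odd_one dvd_triv_left)
qed

lemma card4E:
  assumes "card A = 4" "u \<in> A" "x \<in> A" "u \<noteq> x"
  obtains y z where "A = {u, x, y, z}" "distinct [u, x, y, z]"
proof -
  have "finite A"
    using assms(1) by (metis card.infinite zero_neq_numeral)
  then have "card (A - {u, x}) = 2"
    using assms by (simp add: card_Diff_subset)
  then obtain y z where "A - {u, x} = {y, z}" "y \<noteq> z"
    by (meson card_2_iff)
  then show thesis
    using that[of y z] assms by auto
qed

lemma unit_sum_zero_exE:
  fixes f :: "'a \<Rightarrow> complex"
  assumes "card A = 4" "u \<in> A" "f u = 1" "\<And>i. norm (f i) = 1" "(\<Sum>i\<in>A. f i) = 0"
  obtains x y z where "A = {u, x, y, z}" "distinct [u, x, y, z]" "f x = -1" "f z = - f y"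
proof -
  have "A \<noteq> {u}"
    using assms(1) by auto
  then obtain x where "x \<in> A" "u \<noteq> x"
    using assms(2) by auto
  then obtain y z where A: "A = {u, x, y, z}" "distinct [u, x, y, z]"
    using card4E assms by metis
  then have s: "1 + f x + f y + f z = 0"
    using assms(3,5) by (simp add: add.assoc)
  \<comment> \<open>The first enumeration of \<open>A\<close> only locates an index with value -1. A
    second enumeration then starts from that index.\<close>
  have "\<exists>x'\<in>A. u \<noteq> x' \<and> f x' = -1"
    using unit_sum4_zero[OF _ _ _ s] assms(4) A by auto
  then obtain x' where x': "x' \<in> A" "u \<noteq> x'" "f x' = -1"
    by blast
  then obtain y z where A: "A = {u, x', y, z}" "distinct [u, x', y, z]"
    using card4E assms by metis
  then have "f z = - f y"
    using assms(3,5) x'(3) by (simp add: eq_neg_iff_add_eq_0 add.commute)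
  with A x' that show thesis
    by blast
qed

subsection \<open>Rationality of the spectrum\<close>

lemma expfun_cis: "expfun t x = cis (2 * pi * (t * x))"
  by (simp add: expfun_def cis_conv_exp algebra_simps)

text \<open>Orthogonality of the exponentials with frequencies \<open>t\<close> and 0 is a vanishing
  sum of four unit numbers, in which \<open>b = 0\<close> contributes 1.\<close>

lemma spectral4_half_integer:
  fixes t :: real
  assumes "card B = 4" "spectral_with (real_of_int ` B) \<Lambda>" "0 \<in> B" "0 \<in> \<Lambda>"
    and "t \<in> \<Lambda>" "t \<noteq> 0"
  shows "\<exists>b\<in>B. \<exists>m::int. odd m \<and> 2 * (t * b) = m"
proof -
  have fin: "finite B"
    using assms(1) by (metis card.infinite zero_neq_numeral)
  have "count_inner (real_of_int ` B) (expfun t) (expfun 0) = 0"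
    using assms unfolding spectral_with_def orthogonal_basis_on_def by blast
  then have "(\<Sum>b\<in>B. cis (2 * pi * (t * b))) = 0"
    using fin
    by (simp add: count_inner_def lebesgue_integral_count_space_finite sum.reindex inj_on_def expfun_cis)
  then obtain x y z where "B = {0, x, y, z}" "cis (2 * pi * (t * of_int x)) = -1"
    using unit_sum_zero_exE[of B 0 "\<lambda>b. cis (2 * pi * (t * of_int b))"] assms(1,3)
    by (metis cis_zero mult_zero_right norm_cis of_int_0)
  then show ?thesis
    using cis_2pi_eq_minus_1 by blast
qed

lemma spectral4_rational:
  assumes "card B = 4" "spectral_with (real_of_int ` B) \<Lambda>" "0 \<in> B" "0 \<in> \<Lambda>"
  shows "\<exists>(L::int set) (R::int). 0 \<in> L \<and> R \<ge> 2 \<and>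
           \<Lambda> = (*) (1 / real_of_int R) ` (real_of_int ` L)"
proof -
  have fin: "finite B"
    using assms(1) by (metis card.infinite zero_neq_numeral)
  define P where "P = (\<Prod>b\<in>B - {0}. \<bar>b\<bar>)"
  define R where "R = 2 * P"
  \<comment> \<open>With this choice one inclusion is immediate; what remains is that every element
    of \<Lambda> is a fraction with denominator \<open>R\<close>.\<close>
  define L where "L = {l. real_of_int l / real_of_int R \<in> \<Lambda>}"
  have "P > 0"
    unfolding P_def by (rule prod_pos) auto
  then have R: "R \<ge> 2"
    by (simp add: R_def)
  have "\<exists>l::int. t = l / R" if t: "t \<in> \<Lambda>" for t
  proof (cases "t = 0")
    case False
    then obtain b and m :: int where b: "b \<in> B" "odd m" "2 * (t * b) = m"
      using spectral4_half_integer[OF assms t] by blast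
    then have "b \<noteq> 0"
      by auto
    then have "\<bar>b\<bar> dvd P"
      using b fin unfolding P_def by (intro dvd_prodI) auto
    then have "b dvd P"
      by simp
    then obtain k where "P = b * k"
      by blast
    then have "t * R = real_of_int (m * k)"
      using b by (simp add: R_def algebra_simps flip: b(3))
    then show ?thesis
      using R by (intro exI[of _ "m * k"]) (simp add: field_simps)
  qed (auto intro: exI[of _ 0])
  then have "\<Lambda> = (*) (1 / real_of_int R) ` (real_of_int ` L)"
    by (fastforce simp: L_def image_iff)
  moreover have "0 \<in> L"
    using assms by (simp add: L_def)
  ultimately show ?thesis
    using R by blast
qed

subsection \<open>The shape of the matrix\<close>

text \<open>For \<open>k = b * l\<close> this is the matrix entry before normalization. The integer
  argument lets each value of an entry be read as a condition modulo \<open>R\<close>.\<close>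

definition phase :: "int \<Rightarrow> int \<Rightarrow> complex" where
  "phase R k = cis (2 * pi * (of_int k / of_int R))"

lemma phase_0 [simp]: "phase R 0 = 1"
  by (simp add: phase_def)

lemma norm_phase [simp]: "norm (phase R k) = 1"
  by (simp add: phase_def)

lemma phase_add: "phase R (j + k) = phase R j * phase R k"
  by (simp add: phase_def cis_mult algebra_simps add_divide_distrib)

lemma phase_mult_cnj [simp]: "phase R k * cnj (phase R k) = 1"
  by (simp add: complex_norm_square[symmetric])

lemma phase_eq_1_iff:
  assumes "R \<noteq> 0"
  shows "phase R k = 1 \<longleftrightarrow> R dvd k"
proof
  assume "phase R k = 1"
  then have "real_of_int k / of_int R \<in> \<int>"
    unfolding phase_def cis_2pi_eq_1_iff .
  then obtain m :: int where "of_int k / of_int R = real_of_int m"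
    by (elim Ints_cases)
  then have "real_of_int k = of_int (m * R)"
    using assms by (simp add: field_simps)
  then show "R dvd k"
    unfolding of_int_eq_iff by simp
next
  assume "R dvd k"
  then have "real_of_int k / of_int R \<in> \<int>"
    using assms by auto
  then show "phase R k = 1"
    unfolding phase_def cis_2pi_eq_1_iff .
qed

text \<open>The value -1 means that \<open>k / R\<close> is a half-integer. Doubling keeps the
  condition within the integers for either parity of \<open>R\<close>; for odd \<open>R\<close> both
  sides are false.\<close>

lemma phase_eq_minus_1_iff:
  assumes "R \<noteq> 0"
  shows "phase R k = -1 \<longleftrightarrow> (\<exists>m. odd m \<and> 2 * k = R * m)"
proof
  assume "phase R k = -1"
  then obtain m :: int where m: "odd m" "2 * (of_int k / of_int R) = real_of_int m"
    using cis_2pi_eq_minus_1[of "real_of_int k / of_int R"] unfolding phase_def by blast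
  then have "real_of_int (2 * k) = of_int (R * m)"
    using assms by (simp add: field_simps)
  then show "\<exists>m. odd m \<and> 2 * k = R * m"
    unfolding of_int_eq_iff using m by blast
next
  assume "\<exists>m. odd m \<and> 2 * k = R * m"
  then obtain j where "2 * k = R * (2 * j + 1)"
    by (auto elim: oddE)
  then have "real_of_int (2 * k) = of_int (R * (2 * j + 1))"
    by simp
  then have "of_int k / of_int R = real_of_int j + 1 / 2"
    using assms by (simp add: field_simps)
  then have "phase R k = cis (2 * pi * of_int j) * cis pi"
    by (simp only: phase_def cis_mult) (simp add: algebra_simps)
  also have "cis (2 * pi * of_int j) = 1"
    by (simp only: cis_2pi_eq_1_iff Ints_of_int)
  finally show "phase R k = -1"
    by simp
qed

lemma phase_eq_iff:
  assumes "R \<noteq> 0"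
  shows "phase R j = phase R k \<longleftrightarrow> R dvd (j - k)"
proof -
  have "phase R j = phase R (j - k) * phase R k"
    by (simp flip: phase_add)
  moreover have "phase R k \<noteq> 0"
    by (metis norm_phase norm_zero zero_neq_one)
  ultimately show ?thesis
    using assms by (simp flip: phase_eq_1_iff)
qed

lemma phase_eq_minus_iff:
  assumes "R \<noteq> 0"
  shows "phase R j = - phase R k \<longleftrightarrow> (\<exists>m. odd m \<and> 2 * (j - k) = R * m)"
proof -
  have "phase R j = phase R (j - k) * phase R k"
    by (simp flip: phase_add)
  moreover have "phase R k \<noteq> 0"
    by (metis norm_phase norm_zero zero_neq_one)
  ultimately have "phase R j = - phase R k \<longleftrightarrow> phase R (j - k) = -1"
    by (metis mult_minus_left mult_1 mult_right_cancel)
  then show ?thesis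
    using assms by (simp add: phase_eq_minus_1_iff)
qed

section \<open>Hadamard pairs of size four and their normal form\<close>

text \<open>The normalizing factor is 1/2 and the diagonal conditions hold automatically for unit
  entries, so only orthogonality of distinct rows and of distinct columns remains.\<close>

lemma hadamard_pair_4:
  assumes "R \<ge> 2" "0 \<in> B" "0 \<in> L" "card B = 4" "card L = 4"
  shows "hadamard_pair R B L \<longleftrightarrow>
    (\<forall>b\<in>B. \<forall>b'\<in>B. b \<noteq> b' \<longrightarrow> (\<Sum>l\<in>L. phase R (b * l) * cnj (phase R (b' * l))) = 0) \<and>
    (\<forall>l\<in>L. \<forall>l'\<in>L. l \<noteq> l' \<longrightarrow> (\<Sum>b\<in>B. cnj (phase R (b * l)) * phase R (b * l')) = 0)"
proof -
  have fin: "finite B" "finite L"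
    using assms by (metis card.infinite zero_neq_numeral)+
  have U: "1 / of_real (sqrt (real (card B))) *
      exp (2 * of_real pi * \<i> * inverse (of_int R) * of_int b * of_int l)
      = phase R (b * l) / 2" for b l
    using assms(4) real_sqrt_four
    by (simp add: phase_def cis_conv_exp field_simps)
  have 1: "(\<Sum>l\<in>L. phase R (b * l) / 2 * cnj (phase R (b' * l) / 2)) =
      (\<Sum>l\<in>L. phase R (b * l) * cnj (phase R (b' * l))) / 4" for b b'
    by (simp add: sum_divide_distrib)
  have 2: "(\<Sum>b\<in>B. cnj (phase R (b * l) / 2) * (phase R (b * l') / 2)) =
      (\<Sum>b\<in>B. cnj (phase R (b * l)) * phase R (b * l')) / 4" for l l'
    by (simp add: sum_divide_distrib)
  have "(\<Sum>l\<in>L. phase R (b * l) * cnj (phase R (b * l))) / 4 = 1" for b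
    using assms(5) by simp
  moreover have "(\<Sum>b\<in>B. cnj (phase R (b * l)) * phase R (b * l)) / 4 = 1" for l
    using assms(4) by (simp add: mult.commute)
  ultimately show ?thesis
    using assms fin unfolding hadamard_pair_def unitary_matrix_on_def U 1 2 by auto
qed

text \<open>
  Two rows that have their entry \<open>-1\<close> in different columns can only be orthogonal if one of
  them is real.
\<close>

lemma hadamard_pair_real_row:
  assumes "R \<ge> 2" "0 \<in> B" "0 \<in> L" "card B = 4" "card L = 4" "hadamard_pair R B L"
  obtains b l1 l2 l3 where "b \<in> B" "b \<noteq> 0" "L = {0, l1, l2, l3}" "distinct [0, l1, l2, l3]"
    "phase R (b * l1) = -1" "phase R (b * l2) = -1" "phase R (b * l3) = 1"
proof -
  note H = hadamard_pair_4[OF assms(1-5), THEN iffD1, OF assms(6)]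
  have row: "(\<Sum>l\<in>L. phase R (b * l)) = 0" if "b \<in> B" "b \<noteq> 0" for b
    using H[THEN conjunct1, rule_format, of b 0] that assms by simp
  have col: "(\<Sum>b\<in>B. phase R (b * l)) = 0" if "l \<in> L" "l \<noteq> 0" for l
    using H[THEN conjunct2, rule_format, of 0 l] that assms by simp
  have "B \<noteq> {0}"
    using assms(4) by auto
  then obtain x where x: "x \<in> B" "0 \<noteq> x"
    using assms(2) by auto
  obtain y z where B: "B = {0, x, y, z}" "distinct [0, x, y, z]"
    using card4E[OF assms(4,2) x] by metis
  obtain p q r where L: "L = {0, p, q, r}" "distinct [0, p, q, r]"
    and xp: "phase R (x * p) = -1" and xr: "phase R (x * r) = - phase R (x * q)"
    using unit_sum_zero_exE[OF assms(5,3), of "\<lambda>l. phase R (x * l)"] row[of x] B by auto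
  have sy: "1 + phase R (y * p) + phase R (y * q) + phase R (y * r) = 0"
    using row[of y] B L by (simp add: add.assoc)
  have sz: "1 + phase R (z * p) + phase R (z * q) + phase R (z * r) = 0"
    using row[of z] B L by (simp add: add.assoc)
  have sp: "1 + phase R (x * p) + phase R (y * p) + phase R (z * p) = 0"
    using col[of p] B L by (simp add: add.assoc)
  have xy: "1 + phase R (x * p) * cnj (phase R (y * p)) + phase R (x * q) * cnj (phase R (y * q))
     + phase R (x * r) * cnj (phase R (y * r)) = 0"
    using H[THEN conjunct1, rule_format, of x y] B L by (simp add: add.assoc)
  consider "phase R (y * p) = -1" | "phase R (y * q) = -1" | "phase R (y * r) = -1"
    using unit_sum4_zero[OF _ _ _ sy] by auto
  then show thesis
  proof cases
    case 1
    \<comment> \<open>Rows \<open>x\<close> and \<open>y\<close> share the column of their -1, so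
      column \<open>p\<close> forces a 1 in row \<open>z\<close>. The other two unit entries of that
      row add up to -2, which forces both to be -1.\<close>
    then have zp: "phase R (z * p) = 1"
      using sp xp by simp
    then have s: "phase R (z * q) + phase R (z * r) = -2"
      using sz by algebra
    have "Re (phase R (z * q)) \<ge> -1" "Re (phase R (z * r)) \<ge> -1"
      using abs_Re_le_cmod[of "phase R (z * q)"] abs_Re_le_cmod[of "phase R (z * r)"] by auto
    then have "Re (phase R (z * q)) = -1" "Re (phase R (z * r)) = -1"
      using arg_cong[OF s, of Re] by auto
    then have "phase R (z * q) = -1" "phase R (z * r) = -1"
      using norm_phase[of R "z * q"] norm_phase[of R "z * r"]
      by (auto simp: complex_eq_iff cmod_def)
    then show thesis
      using that[of z q r p] zp B L by auto
  next
    case 2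
    then have yr: "phase R (y * r) = - phase R (y * p)"
      using sy by algebra
    \<comment> \<open>Once the known entries are substituted, the inner product of rows
      \<open>x\<close> and \<open>y\<close> factors. Either factor vanishing gives a row with a
      second entry 1, whose other two entries are -1.\<close>
    have "(1 - phase R (x * q)) * (1 - cnj (phase R (y * p))) = 0"
      using xy unfolding xp xr 2 yr complex_cnj_minus complex_cnj_one by algebra
    then consider "phase R (x * q) = 1" | "phase R (y * p) = 1"
      by (metis complex_cnj_cancel_iff complex_cnj_one mult_eq_0_iff right_minus_eq)
    then show thesis
    proof cases
      case 1
      then show thesis
        using that[of x p r q] xp xr B L by auto
    next
      case h: 2
      then show thesis
        using that[of y q r p] 2 yr B L by auto
    qed
  next
    case 3
    then have yq: "phase R (y * q) = - phase R (y * p)"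
      using sy by algebra
    \<comment> \<open>The same factorization with \<open>q\<close> and \<open>r\<close> exchanged,
      which changes the sign in the first factor because \<open>xr\<close> makes these entries of
      row \<open>x\<close> opposite.\<close>
    have "(1 + phase R (x * q)) * (1 - cnj (phase R (y * p))) = 0"
      using xy unfolding xp xr 3 yq complex_cnj_minus complex_cnj_one by algebra
    then consider "phase R (x * q) = -1" | "phase R (y * p) = 1"
      by (metis complex_cnj_cancel_iff complex_cnj_one mult_eq_0_iff right_minus_eq add_eq_0_iff)
    then show thesis
    proof cases
      case 1
      then show thesis
        using that[of x p q r] xp xr B L by auto
    next
      case 2
      then show thesis
        using that[of y q r p] 3 yq B L by auto
    qed
  qed
qed

text \<open>Let \<open>b1\<close> be a real row and \<open>l3\<close> the column of its second 1.
  Column \<open>l3\<close> then has -1 in the two remaining rows, and the sums over columns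
  \<open>l1\<close>, \<open>l2\<close> and row \<open>b2\<close> determine everything except the
  free entry \<open>phase R (b2 * l1)\<close>.\<close>

lemma hadamard_pair_normal_form:
  assumes "R \<ge> 2" "0 \<in> B" "0 \<in> L" "card B = 4" "card L = 4" "hadamard_pair R B L"
  obtains b1 b2 b3 l1 l2 l3 where "B = {0, b1, b2, b3}" "L = {0, l1, l2, l3}"
    "phase R (b1 * l1) = -1" "phase R (b1 * l2) = -1" "phase R (b1 * l3) = 1"
    "phase R (b2 * l3) = -1" "phase R (b3 * l3) = -1"
    "phase R (b3 * l1) = - phase R (b2 * l1)" "phase R (b2 * l2) = - phase R (b2 * l1)"
    "phase R (b3 * l2) = phase R (b2 * l1)"
proof -
  note H = hadamard_pair_4[OF assms(1-5), THEN iffD1, OF assms(6)]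
  have row: "(\<Sum>l\<in>L. phase R (b * l)) = 0" if "b \<in> B" "b \<noteq> 0" for b
    using H[THEN conjunct1, rule_format, of b 0] that assms by simp
  have col: "(\<Sum>b\<in>B. phase R (b * l)) = 0" if "l \<in> L" "l \<noteq> 0" for l
    using H[THEN conjunct2, rule_format, of 0 l] that assms by simp
  obtain b1 l1 l2 l3 where b1: "b1 \<in> B" "b1 \<noteq> 0"
    and L: "L = {0, l1, l2, l3}" "distinct [0, l1, l2, l3]"
    and e1: "phase R (b1 * l1) = -1" "phase R (b1 * l2) = -1" "phase R (b1 * l3) = 1"
    by (rule hadamard_pair_real_row[OF assms])
  obtain b2 b3 where B: "B = {0, b1, b2, b3}" "distinct [0, b1, b2, b3]"
    using card4E[OF assms(4,2)] b1 by metis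
  obtain u v w where uvw: "B = {0, u, v, w}" "distinct [0, u, v, w]"
      "phase R (u * l3) = -1" "phase R (w * l3) = - phase R (v * l3)"
    using unit_sum_zero_exE[OF assms(4,2), of "\<lambda>b. phase R (b * l3)"] col[of l3] L by auto
  have "b1 \<noteq> u"
    using uvw(3) e1(3) by auto
  \<comment> \<open>Since \<open>b1\<close> is not \<open>u\<close>, it is \<open>v\<close> or
    \<open>w\<close>; its entry 1 in column \<open>l3\<close> makes the entry of the other one
    -1.\<close>
  then have "phase R (b * l3) = -1" if "b \<in> B" "b \<noteq> 0" "b \<noteq> b1" for b
    using that b1 uvw(3,4) e1(3) unfolding uvw(1) by (auto simp: minus_equation_iff[of _ 1])
  then have e3: "phase R (b2 * l3) = -1" "phase R (b3 * l3) = -1"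
    using B by auto
  have s: "1 + phase R (b1 * l1) + phase R (b2 * l1) + phase R (b3 * l1) = 0"
    "1 + phase R (b1 * l2) + phase R (b2 * l2) + phase R (b3 * l2) = 0"
    "1 + phase R (b2 * l1) + phase R (b2 * l2) + phase R (b2 * l3) = 0"
    using col[of l1] col[of l2] row[of b2] L B by (simp_all add: add.assoc)
  have "phase R (b3 * l1) = - phase R (b2 * l1)"
    using s(1) e1 by algebra
  moreover have "phase R (b3 * l2) = - phase R (b2 * l2)"
    using s(2) e1 by algebra
  moreover have "phase R (b2 * l2) = - phase R (b2 * l1)"
    using s(3) e3 by algebra
  ultimately show thesis
    using that[OF B(1) L(1) e1 e3] by simp
qed

lemma hadamard_pair_of_normal_form:
  assumes "R \<ge> 2" "card B = 4" "card L = 4" "B = {0, b1, b2, b3}" "L = {0, l1, l2, l3}"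
    and e: "phase R (b1 * l1) = -1" "phase R (b1 * l2) = -1" "phase R (b1 * l3) = 1"
    "phase R (b2 * l3) = -1" "phase R (b3 * l3) = -1"
    "phase R (b3 * l1) = - phase R (b2 * l1)" "phase R (b2 * l2) = - phase R (b2 * l1)"
    "phase R (b3 * l2) = phase R (b2 * l1)"
  shows "hadamard_pair R B L"
proof -
  \<comment> \<open>Cardinality four makes the listed elements distinct, so the sums over
    \<open>B\<close> and \<open>L\<close> split into four terms each.\<close>
  have d: "distinct [0, b1, b2, b3]" "distinct [0, l1, l2, l3]"
    using assms(2-5) by (auto simp: card_insert_if split: if_splits)
  have c: "cnj (phase R k) * phase R k = 1" for k
    using phase_mult_cnj by (simp only: mult.commute)
  have B: "(\<Sum>b\<in>B. f b) = f 0 + f b1 + f b2 + f b3" for f :: "int \<Rightarrow> complex"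
    using assms(4) d by (simp add: add.assoc)
  have L: "(\<Sum>l\<in>L. f l) = f 0 + f l1 + f l2 + f l3" for f :: "int \<Rightarrow> complex"
    using assms(5) d by (simp add: add.assoc)
  have "0 \<in> B" "0 \<in> L"
    using assms by auto
  moreover have "(\<Sum>l\<in>L. phase R (b * l) * cnj (phase R (b' * l))) = 0"
    if "b \<in> B" "b' \<in> B" "b \<noteq> b'" for b b'
    using that unfolding assms(4) by (auto simp: L e c)
  moreover have "(\<Sum>b\<in>B. cnj (phase R (b * l)) * phase R (b * l')) = 0"
    if "l \<in> L" "l' \<in> L" "l \<noteq> l'" for l l'
    using that unfolding assms(5) by (auto simp: B e c)
  ultimately show ?thesis
    using assms(1-3) by (subst hadamard_pair_4) auto
qed

subsection \<open>Powers of two and odd parts\<close>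

lemma int_odd_part:
  fixes x :: int
  assumes "x \<noteq> 0"
  obtains k u where "x = 2 ^ k * u" "odd u"
  using multiplicity_decompose'[of x 2] assms that by fastforce

text \<open>Odd numbers are coprime to powers of 2, so the divisibility separates into a comparison
  of exponents and one of odd parts.\<close>

lemma dvd_odd_part:
  fixes d u :: int
  assumes "2 ^ i * d dvd 2 ^ j * u" "odd u" "odd d"
  shows "i \<le> j \<and> d dvd u"
proof
  have "d dvd 2 ^ j * u"
    using assms(1) by (rule dvd_mult_right)
  then show "d dvd u"
    using \<open>odd d\<close> by (simp add: coprime_dvd_mult_right_iff)
  have "2 ^ i dvd u * 2 ^ j"
    using assms(1) by (metis dvd_mult_left mult.commute)
  then have "(2::int) ^ i dvd 2 ^ j"
    using \<open>odd u\<close> by (simp add: coprime_dvd_mult_right_iff)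
  then show "i \<le> j"
    by (simp add: dvd_power_iff)
qed

text \<open>An entry -1 fixes the exponent of 2 in the scaling factor exactly: the equation gives
  divisibility in both directions, and as \<open>m\<close> is odd, all powers of 2 are visible. The
  \<open>+ 1\<close> is the factor 2 on the left.\<close>

lemma odd_multiple_of_half:
  fixes d u v m :: int
  assumes "2 * ((2 ^ i * u) * (2 ^ j * v)) = 2 ^ r * d * m"
    and "odd u" "odd v" "odd d" "odd m"
  shows "r = i + j + 1 \<and> d dvd u * v"
proof -
  have eq: "2 ^ (i + j + 1) * (u * v) = 2 ^ r * (d * m)"
    using assms(1) by (simp add: power_add algebra_simps)
  have "r \<le> i + j + 1 \<and> d * m dvd u * v"
    by (rule dvd_odd_part) (use assms eq in auto)
  moreover have "i + j + 1 \<le> r \<and> u * v dvd d * m"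
    by (rule dvd_odd_part) (use assms eq in auto)
  ultimately show ?thesis
    by (auto dest: dvd_mult_left)
qed

lemma dvd_mult_gcd:
  fixes d k x y :: int
  assumes "d dvd k * x" "d dvd k * y"
  shows "d dvd k * gcd x y"
proof -
  have "d dvd gcd (k * x) (k * y)"
    using assms by simp
  also have "\<dots> = \<bar>k * gcd x y\<bar>"
    by (simp add: gcd_mult_left abs_mult)
  finally show ?thesis
    by simp
qed

section \<open>Translation between normal form and integer parameters\<close>

text \<open>The parameters come from the odd parts of \<open>b1\<close>, \<open>b2\<close>,
  \<open>b3 - b2\<close> and \<open>l1\<close>, \<open>l2 - l1\<close>, \<open>l3\<close>. Four
  products of these are odd multiples of \<open>R / 2\<close> and give equations between exponents;
  four are multiples of \<open>R\<close> and give inequalities.\<close>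

lemma normal_form_parameters:
  fixes b1 b2 b3 l1 l2 l3 :: int
  assumes R: "R > 0"
    and e: "phase R (b1 * l1) = -1" "phase R (b1 * l2) = -1" "phase R (b1 * l3) = 1"
    "phase R (b2 * l3) = -1" "phase R (b3 * l3) = -1"
    "phase R (b3 * l1) = - phase R (b2 * l1)" "phase R (b2 * l2) = - phase R (b2 * l1)"
    "phase R (b3 * l2) = phase R (b2 * l1)"
  obtains c1 c2 c3 n1 n2 n3 d :: int and a C M :: nat where
    "R = 2 ^ (C + M + a + 1) * d"
    "b1 = 2 ^ C * (2 ^ a * c1)" "b2 = 2 ^ C * c2" "b3 = 2 ^ C * (c2 + 2 ^ a * c3)"
    "l1 = 2 ^ M * n1" "l2 = 2 ^ M * (n1 + 2 ^ a * n2)" "l3 = 2 ^ M * (2 ^ a * n3)"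
    "odd c1" "odd c2" "odd c3" "odd n1" "odd n2" "odd n3" "a > 0"
    "d dvd c1 * gcd n1 (gcd n2 n3)" "d dvd c3 * gcd n1 (gcd n2 n3)"
    "d dvd n2 * gcd c1 (gcd c2 c3)" "d dvd n3 * gcd c1 (gcd c2 c3)"
proof -
  have R0: "R \<noteq> 0"
    using R by simp
  obtain m1 where m1: "odd m1" "2 * (b1 * l1) = R * m1"
    using e(1) R0 phase_eq_minus_1_iff by blast
  obtain m2 where m2: "odd m2" "2 * (b2 * l3) = R * m2"
    using e(4) R0 phase_eq_minus_1_iff by blast
  obtain m3 where m3: "odd m3" "2 * ((b3 - b2) * l1) = R * m3"
    using e(6) phase_eq_minus_iff[OF R0] by (metis left_diff_distrib)
  obtain m4 where m4: "odd m4" "2 * (b2 * (l2 - l1)) = R * m4"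
    using e(7) phase_eq_minus_iff[OF R0] by (metis right_diff_distrib)
  have z1: "R dvd b1 * (l2 - l1)"
    using e(1,2) phase_eq_iff[OF R0] by (metis right_diff_distrib)
  have z2: "R dvd b1 * l3"
    using e(3) phase_eq_1_iff[OF R0] by blast
  have z3: "R dvd (b3 - b2) * l3"
    using e(4,5) phase_eq_iff[OF R0] by (metis left_diff_distrib)
  \<comment> \<open>With \<open>w\<close> the free entry, both sides equal \<open>w * w\<close>; on
    the right the two signs cancel.\<close>
  have "phase R (b3 * l2 + b2 * l1) = phase R (b3 * l1 + b2 * l2)"
    by (simp add: phase_add e)
  then have "R dvd (b3 * l2 + b2 * l1) - (b3 * l1 + b2 * l2)"
    using phase_eq_iff[OF R0] by blast
  then have z4: "R dvd (b3 - b2) * (l2 - l1)"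
    by (simp add: algebra_simps)
  have nz: "b1 \<noteq> 0" "l1 \<noteq> 0" "b2 \<noteq> 0" "l3 \<noteq> 0" "b3 - b2 \<noteq> 0" "l2 - l1 \<noteq> 0"
    using m1 m2 m3 m4 R0 by auto
  obtain k1 c1 where c1: "b1 = 2 ^ k1 * c1" "odd c1" using int_odd_part nz by blast
  obtain C c2 where c2: "b2 = 2 ^ C * c2" "odd c2" using int_odd_part nz by blast
  obtain k3 c3 where c3: "b3 - b2 = 2 ^ k3 * c3" "odd c3" using int_odd_part nz by blast
  obtain M n1 where n1: "l1 = 2 ^ M * n1" "odd n1" using int_odd_part nz by blast
  obtain j2 n2 where n2: "l2 - l1 = 2 ^ j2 * n2" "odd n2" using int_odd_part nz by blast
  obtain j3 n3 where n3: "l3 = 2 ^ j3 * n3" "odd n3" using int_odd_part nz by blast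
  obtain r d where d: "R = 2 ^ r * d" "odd d" using int_odd_part R0 by blast
  have h1: "r = k1 + M + 1 \<and> d dvd c1 * n1"
    by (rule odd_multiple_of_half[of _ _ _ _ _ _ m1]) (use m1 c1 n1 d in auto)
  have h2: "r = C + j3 + 1 \<and> d dvd c2 * n3"
    by (rule odd_multiple_of_half[of _ _ _ _ _ _ m2]) (use m2 c2 n3 d in auto)
  have h3: "r = k3 + M + 1 \<and> d dvd c3 * n1"
    by (rule odd_multiple_of_half[of _ _ _ _ _ _ m3]) (use m3 c3 n1 d in auto)
  have h4: "r = C + j2 + 1 \<and> d dvd c2 * n2"
    by (rule odd_multiple_of_half[of _ _ _ _ _ _ m4]) (use m4 c2 n2 d in auto)
  have p: "2 ^ i * u * (2 ^ j * v) = 2 ^ (i + j) * (u * v)" for i j and u v :: int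
    by (simp add: power_add algebra_simps)
  have z1': "r \<le> k1 + j2 \<and> d dvd c1 * n2"
    by (rule dvd_odd_part) (use z1 c1 n2 d in \<open>auto simp flip: p\<close>)
  have z2': "r \<le> k1 + j3 \<and> d dvd c1 * n3"
    by (rule dvd_odd_part) (use z2 c1 n3 d in \<open>auto simp flip: p\<close>)
  have z3': "r \<le> k3 + j3 \<and> d dvd c3 * n3"
    by (rule dvd_odd_part) (use z3 c3 n3 d in \<open>auto simp flip: p\<close>)
  have z4': "r \<le> k3 + j2 \<and> d dvd c3 * n2"
    by (rule dvd_odd_part) (use z4 c3 n2 d in \<open>auto simp flip: p\<close>)
  \<comment> \<open>From \<open>h1\<close> and \<open>h2\<close>, \<open>k1 + M = C + j3\<close>,
    and \<open>z2'\<close> with \<open>h1\<close> gives \<open>j3 > M\<close>. Hence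
    \<open>k1 > C\<close>, so the subtraction of naturals is not truncated and \<open>a\<close> is
    positive.\<close>
  define a where "a = k1 - C"
  have k: "k1 = C + a" "k3 = C + a" "j2 = M + a" "j3 = M + a" "a > 0" "r = C + M + a + 1"
    using h1 h2 h3 h4 z1' z2' z3' z4' by (auto simp: a_def)
  show thesis
  proof (rule that)
    show "b3 = 2 ^ C * (c2 + 2 ^ a * c3)"
      using c2(1) c3(1) k by (simp add: power_add algebra_simps)
    show "l2 = 2 ^ M * (n1 + 2 ^ a * n2)"
      using n1(1) n2(1) k by (simp add: power_add algebra_simps)
    \<comment> \<open>The eight divisibilities cover every product of some \<open>ci\<close> and
      \<open>nj\<close> except \<open>c2 * n1\<close>, which belongs to the free entry. The gcd
      conditions collect exactly these eight.\<close>
    show "d dvd c1 * gcd n1 (gcd n2 n3)" "d dvd c3 * gcd n1 (gcd n2 n3)"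
      "d dvd n2 * gcd c1 (gcd c2 c3)" "d dvd n3 * gcd c1 (gcd c2 c3)"
      using h1 h2 h3 h4 z1' z2' z3' z4' by (auto intro!: dvd_mult_gcd simp: mult.commute)
  qed (use c1 c2 c3 n1 n2 n3 d k in \<open>auto simp: power_add mult.assoc\<close>)
qed

text \<open>With \<open>E = 2 ^ (C + M + a)\<close> the scaling factor is \<open>2 * E * d\<close>.
  Each product is expanded into odd multiples of \<open>E * d\<close>, which contribute -1, and
  multiples of \<open>R\<close>, which contribute 1; \<open>b2 * l1\<close> stays unexpanded because
  its phase is free.\<close>

lemma normal_form_of_parameters:
  fixes c1 c2 c3 n1 n2 n3 d :: int and a C M :: nat
  defines "R \<equiv> 2 ^ (C + M + a + 1) * d"
  defines "b1 \<equiv> 2 ^ C * (2 ^ a * c1)" and "b2 \<equiv> 2 ^ C * c2" and "b3 \<equiv> 2 ^ C * (c2 + 2 ^ a * c3)"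
  defines "l1 \<equiv> 2 ^ M * n1" and "l2 \<equiv> 2 ^ M * (n1 + 2 ^ a * n2)" and "l3 \<equiv> 2 ^ M * (2 ^ a * n3)"
  assumes R: "R \<noteq> 0"
    and odd: "odd c1" "odd c2" "odd c3" "odd n1" "odd n2" "odd n3" and a: "a > 0"
    and d: "d dvd c1 * gcd n1 (gcd n2 n3)" "d dvd c3 * gcd n1 (gcd n2 n3)"
    "d dvd n2 * gcd c1 (gcd c2 c3)" "d dvd n3 * gcd c1 (gcd c2 c3)"
  shows "phase R (b1 * l1) = -1 \<and> phase R (b1 * l2) = -1 \<and> phase R (b1 * l3) = 1 \<and>
    phase R (b2 * l3) = -1 \<and> phase R (b3 * l3) = -1 \<and>
    phase R (b3 * l1) = - phase R (b2 * l1) \<and> phase R (b2 * l2) = - phase R (b2 * l1) \<and>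
    phase R (b3 * l2) = phase R (b2 * l1)"
proof -
  have dv: "d dvd c1 * n1" "d dvd c1 * n2" "d dvd c1 * n3"
    "d dvd c3 * n1" "d dvd c3 * n2" "d dvd c3 * n3" "d dvd n2 * c2" "d dvd n3 * c2"
    using d by (meson dvd_trans mult_dvd_mono dvd_refl gcd_dvd1 gcd_dvd2)+
  have half: "phase R (2 ^ (C + M + a) * k) = -1" if "d dvd k" "odd k" for k
  proof -
    obtain m where m: "k = d * m"
      using \<open>d dvd k\<close> by blast
    then have "odd m" "2 * (2 ^ (C + M + a) * k) = R * m"
      using that by (auto simp: R_def)
    then show ?thesis
      using phase_eq_minus_1_iff[OF R] by blast
  qed
  have whole: "phase R (2 ^ (C + M + a) * (2 ^ a * k)) = 1" if "d dvd k" for k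
  proof -
    obtain m where m: "k = d * m"
      using \<open>d dvd k\<close> by blast
    \<comment> \<open>Positivity of \<open>a\<close> supplies the one further factor 2 that turns a
      multiple of \<open>R / 2\<close> into a multiple of \<open>R\<close>.\<close>
    have "(2::int) ^ a = 2 * 2 ^ (a - 1)"
      using a by (simp flip: power_Suc)
    then have "2 ^ (C + M + a) * (2 ^ a * k) = R * (2 ^ (a - 1) * m)"
      by (simp add: R_def m)
    then show ?thesis
      using phase_eq_1_iff[OF R] by simp
  qed
  define E where "E = (2::int) ^ (C + M + a)"
  have b1: "b1 * l1 = E * (c1 * n1)" "b1 * l2 = E * (c1 * n1) + E * (2 ^ a * (c1 * n2))"
    "b1 * l3 = E * (2 ^ a * (c1 * n3))"
    by (simp_all add: b1_def l1_def l2_def l3_def E_def power_add algebra_simps)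
  have b2: "b2 * l3 = E * (n3 * c2)" "b2 * l2 = b2 * l1 + E * (n2 * c2)"
    by (simp_all add: b2_def l1_def l2_def l3_def E_def power_add algebra_simps)
  have b3: "b3 * l3 = b2 * l3 + E * (2 ^ a * (c3 * n3))" "b3 * l1 = b2 * l1 + E * (c3 * n1)"
    "b3 * l2 = b2 * l1 + E * (n2 * c2) + E * (c3 * n1) + E * (2 ^ a * (c3 * n2))"
    by (simp_all add: b2_def b3_def l1_def l2_def l3_def E_def power_add algebra_simps)
  note [simp] = half[folded E_def] whole[folded E_def] phase_add dv odd
  show ?thesis
    unfolding b3 b1 b2(2) by (simp add: b2(1))
qed

theorem theorem1p20:
  shows "(\<forall>(B::int set) (\<Lambda>::real set).
            card B = 4 \<and> spectral_with (real_of_int ` B) \<Lambda> \<and> 0 \<in> B \<and> 0 \<in> \<Lambda> \<longrightarrow>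
            (\<exists>(L::int set) (R::int). 0 \<in> L \<and> R \<ge> 2 \<and>
               \<Lambda> = (*) (1 / real_of_int R) ` (real_of_int ` L)))
       \<and> (\<forall>(R::int) (B::int set) (L::int set).
            R \<ge> 2 \<and> 0 \<in> B \<and> 0 \<in> L \<and> card B = 4 \<and> card L = 4 \<longrightarrow>
            (hadamard_pair R B L \<longleftrightarrow>
             (\<exists>(c1::int) (c2::int) (c3::int) (n1::int) (n2::int) (n3::int)
               (a::nat) (C::nat) (M::nat) (d::int).
                R = 2 ^ (C + M + a + 1) * d \<and>
                B = (*) (2 ^ C) ` {0, 2 ^ a * c1, c2, c2 + 2 ^ a * c3} \<and>
                L = (*) (2 ^ M) ` {0, n1, n1 + 2 ^ a * n2, 2 ^ a * n3} \<and>
                odd c1 \<and> odd c2 \<and> odd c3 \<and> odd n1 \<and> odd n2 \<and> odd n3 \<and> a > 0 \<and>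
                (let c = gcd c1 (gcd c2 c3); n = gcd n1 (gcd n2 n3) in
                   d dvd c1 * n \<and> d dvd c3 * n \<and> d dvd n2 * c \<and> d dvd n3 * c))))"
  (is "_ \<and> (\<forall>R B L. ?H R B L \<longrightarrow> (_ \<longleftrightarrow> ?P R B L))")
proof (intro conjI allI impI iffI)
  show "\<exists>(L::int set) (R::int). 0 \<in> L \<and> R \<ge> 2 \<and>
      \<Lambda> = (*) (1 / real_of_int R) ` (real_of_int ` L)"
    if "card B = 4 \<and> spectral_with (real_of_int ` B) \<Lambda> \<and> 0 \<in> B \<and> 0 \<in> \<Lambda>"
    for B :: "int set" and \<Lambda>
    using spectral4_rational that by blast
next
  fix R :: int and B L :: "int set"
  assume H: "?H R B L" and had: "hadamard_pair R B L"
  from H have H': "R \<ge> 2" "0 \<in> B" "0 \<in> L" "card B = 4" "card L = 4"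
    by auto
  obtain b1 b2 b3 l1 l2 l3 where B: "B = {0, b1, b2, b3}" and L: "L = {0, l1, l2, l3}"
    and e: "phase R (b1 * l1) = -1" "phase R (b1 * l2) = -1" "phase R (b1 * l3) = 1"
    "phase R (b2 * l3) = -1" "phase R (b3 * l3) = -1"
    "phase R (b3 * l1) = - phase R (b2 * l1)" "phase R (b2 * l2) = - phase R (b2 * l1)"
    "phase R (b3 * l2) = phase R (b2 * l1)"
    by (rule hadamard_pair_normal_form[OF H' had])
  have "R > 0"
    using H by simp
  then show "?P R B L"
  proof (rule normal_form_parameters[OF _ e], goal_cases)
    case (1 c1 c2 c3 n1 n2 n3 d a C M)
    have "B = (*) (2 ^ C) ` {0, 2 ^ a * c1, c2, c2 + 2 ^ a * c3}"
      unfolding B 1 by simp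
    moreover have "L = (*) (2 ^ M) ` {0, n1, n1 + 2 ^ a * n2, 2 ^ a * n3}"
      unfolding L 1 by simp
    ultimately show ?case
      using 1 unfolding Let_def
      by - (rule exI[of _ c1], rule exI[of _ c2], rule exI[of _ c3],
          rule exI[of _ n1], rule exI[of _ n2], rule exI[of _ n3],
          rule exI[of _ a], rule exI[of _ C], rule exI[of _ M], rule exI[of _ d],
          intro conjI; assumption)
  qed
next
  fix R :: int and B L :: "int set"
  assume H: "?H R B L" and "?P R B L"
  then obtain c1 c2 c3 n1 n2 n3 d :: int and a C M :: nat where
    R: "R = 2 ^ (C + M + a + 1) * d" and
    BL: "B = (*) (2 ^ C) ` {0, 2 ^ a * c1, c2, c2 + 2 ^ a * c3}"
       "L = (*) (2 ^ M) ` {0, n1, n1 + 2 ^ a * n2, 2 ^ a * n3}" and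
    P: "odd c1" "odd c2" "odd c3" "odd n1" "odd n2" "odd n3" "a > 0"
    "d dvd c1 * gcd n1 (gcd n2 n3)" "d dvd c3 * gcd n1 (gcd n2 n3)"
    "d dvd n2 * gcd c1 (gcd c2 c3)" "d dvd n3 * gcd c1 (gcd c2 c3)"
    unfolding Let_def by (elim exE conjE) (rule that; assumption)
  have "R \<noteq> 0"
    using H by simp
  note nf = normal_form_of_parameters[OF this[unfolded R] P, folded R]
  \<comment> \<open>The enumerations are given explicitly, since the sets \<open>B\<close> and
    \<open>L\<close> alone do not say which element plays which role.\<close>
  show "hadamard_pair R B L"
    by (rule hadamard_pair_of_normal_form[where ?b1.0 = "2 ^ C * (2 ^ a * c1)"
          and ?b2.0 = "2 ^ C * c2" and ?b3.0 = "2 ^ C * (c2 + 2 ^ a * c3)"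
          and ?l1.0 = "2 ^ M * n1" and ?l2.0 = "2 ^ M * (n1 + 2 ^ a * n2)"
          and ?l3.0 = "2 ^ M * (2 ^ a * n3)"])
      (use H nf in \<open>simp_all add: BL\<close>)
qed

end
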